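(* Let $d\ge 3$ be an integer, let $G$ be a $C_4$-free graph of maximum degree $d$, and let $M$ be an induced matching of $G$ produced by applying Local Search to $G$. Then the following statements hold. (i) Let $xy$ be an edge in $M$. Let $N_1$ be the set of vertices in $(N_G(x)\cup N_G(y))\setminus\{x,y\}$ that are incident with an edge in $PC_G(M,xy)$, and let $N_2$ be the set of vertices in $V(G)\setminus(N_G[x]\cup N_G[y])$ that are incident with an edge in $PC_G(M,xy)$. Then $m_G(N_1,N_2)\leq\max\left\{d,\frac{d^2}{4}\right\}$. (ii) $|M|\geq\dfrac{m(G)}{\max\left\{d^2+\frac{d}{2},\frac{9}{8}d^2\right\}}$.
   Context: Graphs are finite, simple, and undirected; $V(G)$, $E(G)$ are the vertex and edge sets and $m(G)=|E(G)|$. $N_G(u)$ is the neighborhood of $u$ and $N_G[u]=\{u\}\cup N_G(u)$. For disjoint sets $X,Y\subseteq V(G)$, $m_G(X,Y)$ is the number of edges $uv$ of $G$ with $u\in X$ and $v\in Y$. $C_4$ is the cycle of order $4$; $G$ is $C_4$-free if it contains no $C_4$ as an induced subgraph. A set $M\subseteq E(G)$ is an induced matching of $G$ if the subgraph of $G$ induced by the set of vertices incident with edges in $M$ is $1$-regular (the empty set is an induced matching). For an edge $e$ of $G$, $C_G(e)=\{f\in E(G):\mathrm{dist}_{L(G)}(e,f)\leq 2\}$, where $L(G)$ is the line graph of $G$ (so $C_G(e)$ consists of $e$, all edges sharing a vertex with $e$, and all edges joined to $e$ by an edge of $G$). For a set $M$ of edges and $e\in M$, $PC_G(M,e)=C_G(e)\setminus\bigcup_{f\in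 M\setminus\{e\}}C_G(f)$. Local Search is the following algorithm on input $G$: start with $M=\emptyset$ and repeat the following iteration: (1) if $M\cup\{e\}$ is an induced matching of $G$ for some edge $e\in E(G)\setminus M$, replace $M$ by $M\cup\{e\}$; (2) if $(M\setminus\{e\})\cup\{e',e''\}$ is an induced matching of $G$ for some three distinct edges $e\in M$ and $e',e''\in E(G)\setminus M$, replace $M$ by $(M\setminus\{e\})\cup\{e',e''\}$. The choices are arbitrary. Stop when $|M|$ does not increase during one iteration (i.e. neither (1) nor (2) is possible), and return $M$. *)

theory Defs
  imports Complex_Main "HOL-Library.Extended_Nat"
begin

datatype 'a graph = Graph (verts: "'a set") (edges: "'a set set")

definition finite_simple_graph :: "'a graph \<Rightarrow> bool" where
  "finite_simple_graph G \<longleftrightarrow>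
     finite (verts G) \<and> (\<forall>e\<in>edges G. e \<subseteq> verts G \<and> card e = 2)"

definition nbhd :: "'a graph \<Rightarrow> 'a \<Rightarrow> 'a set" where
  "nbhd G u = {v. {u, v} \<in> edges G}"

definition closed_nbhd :: "'a graph \<Rightarrow> 'a \<Rightarrow> 'a set" where
  "closed_nbhd G u = insert u (nbhd G u)"

definition degree :: "'a graph \<Rightarrow> 'a \<Rightarrow> nat" where
  "degree G u = card (nbhd G u)"

text \<open>The inserted 0 only matters for the graph without vertices.\<close>

definition max_degree :: "'a graph \<Rightarrow> nat" where
  "max_degree G = Max (insert 0 (degree G ` verts G))"

definition regular :: "nat \<Rightarrow> 'a graph \<Rightarrow> bool" where
  "regular k G \<longleftrightarrow> (\<forall>v\<in>verts G. degree G v = k)"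

definition num_edges :: "'a graph \<Rightarrow> nat" where
  "num_edges G = card (edges G)"

definition num_edges_between :: "'a graph \<Rightarrow> 'a set \<Rightarrow> 'a set \<Rightarrow> nat" where
  "num_edges_between G X Y = card {e \<in> edges G. \<exists>u\<in>X. \<exists>v\<in>Y. e = {u, v}}"

definition induced_subgraph :: "'a graph \<Rightarrow> 'a set \<Rightarrow> 'a graph" where
  "induced_subgraph G S = Graph S {e \<in> edges G. e \<subseteq> S}"

definition isomorphic :: "'a graph \<Rightarrow> 'b graph \<Rightarrow> bool" where
  "isomorphic G H \<longleftrightarrow>
     (\<exists>f. bij_betw f (verts G) (verts H) \<and> (\<lambda>e. f ` e) ` edges G = edges H)"

definition C4 :: "nat graph" where
  "C4 = Graph {0, 1, 2, 3} {{0, 1}, {1, 2}, {2, 3}, {3, 0}}"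

definition C4_free :: "'a graph \<Rightarrow> bool" where
  "C4_free G \<longleftrightarrow> \<not> (\<exists>S\<subseteq>verts G. isomorphic (induced_subgraph G S) C4)"

text \<open>
  The condition forces every edge of the subgraph induced by \<open>\<Union>M\<close> to belong to \<open>M\<close>:
  each vertex in \<open>\<Union>M\<close> lies on an edge of \<open>M\<close>, and on no other edge of that subgraph.
\<close>

definition induced_matching :: "'a graph \<Rightarrow> 'a set set \<Rightarrow> bool" where
  "induced_matching G M \<longleftrightarrow> M \<subseteq> edges G \<and> regular 1 (induced_subgraph G (\<Union>M))"

definition line_graph :: "'a graph \<Rightarrow> 'a set graph" where
  "line_graph G =
     Graph (edges G) {{e, f} | e f. e \<in> edges G \<and> f \<in> edges G \<and> e \<noteq> f \<and> e \<inter> f \<noteq> {}}"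

text \<open>
  The least length of a walk from \<open>u\<close> to \<open>v\<close>; the infimum of the empty set is \<open>\<infinity>\<close>.
\<close>

definition graph_dist :: "'a graph \<Rightarrow> 'a \<Rightarrow> 'a \<Rightarrow> enat" where
  "graph_dist G u v = (INF n\<in>{n. (u, v) \<in> {(a, b). {a, b} \<in> edges G} ^^ n}. enat n)"

definition conflict_set :: "'a graph \<Rightarrow> 'a set \<Rightarrow> 'a set set" where
  "conflict_set G e = {f \<in> edges G. graph_dist (line_graph G) e f \<le> 2}"

definition private_conflict_set :: "'a graph \<Rightarrow> 'a set set \<Rightarrow> 'a set \<Rightarrow> 'a set set" where
  "private_conflict_set G M e = conflict_set G e - (\<Union>f\<in>M - {e}. conflict_set G f)"

definition ls_add_results :: "'a graph \<Rightarrow> 'a set set \<Rightarrow> 'a set set set" where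
  "ls_add_results G M =
     {M \<union> {e} | e. e \<in> edges G - M \<and> induced_matching G (M \<union> {e})}"

definition ls_swap_results :: "'a graph \<Rightarrow> 'a set set \<Rightarrow> 'a set set set" where
  "ls_swap_results G M =
     {(M - {e}) \<union> {e', e''} | e e' e''.
        e \<in> M \<and> e' \<in> edges G - M \<and> e'' \<in> edges G - M \<and> e' \<noteq> e'' \<and>
        induced_matching G ((M - {e}) \<union> {e', e''})}"

text \<open>
  Local Search makes arbitrary choices, so it is modelled by relations. One iteration first
  tries to add an edge and then, starting from the outcome, tries to exchange one edge for two;
  a part that is not applicable leaves the matching unchanged.
\<close>

definition ls_choose :: "'a set set set \<Rightarrow> 'a set set \<Rightarrow> 'a set set \<Rightarrow> bool" where
  "ls_choose R M M' \<longleftrightarrow> (if R = {} then M' = M else M' \<in> R)"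

definition ls_iteration :: "'a graph \<Rightarrow> 'a set set \<Rightarrow> 'a set set \<Rightarrow> bool" where
  "ls_iteration G M M'' \<longleftrightarrow>
     (\<exists>M'. ls_choose (ls_add_results G M) M M' \<and> ls_choose (ls_swap_results G M') M' M'')"

text \<open>
  A run from the empty matching performs iterations that increase the cardinality, followed by a
  last one that does not; the matching after the last iteration is returned.
\<close>

definition local_search_output :: "'a graph \<Rightarrow> 'a set set \<Rightarrow> bool" where
  "local_search_output G M \<longleftrightarrow>
     (\<exists>M\<^sub>0. (\<lambda>A B. ls_iteration G A B \<and> card A < card B)\<^sup>*\<^sup>* {} M\<^sub>0 \<and>
           ls_iteration G M\<^sub>0 M \<and> \<not> card M\<^sub>0 < card M)"

end

theory Submission
  imports Defs
begin

text \<open>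
  Two edges conflict if they share a vertex or are joined by an edge; an induced matching is a set
  of pairwise non-conflicting edges. Local Search stops only at an induced matching \<open>M\<close> such that
  every edge conflicts with some edge of \<open>M\<close> (otherwise it could be added) and any two edges that
  are private to the same \<open>xy \<in> M\<close> conflict (otherwise they could replace \<open>xy\<close>).

  Fix \<open>xy \<in> M\<close> and call a vertex free if it neither lies on nor is adjacent to any other edge of
  \<open>M\<close>. The private conflict set of \<open>xy\<close> is exactly the set of edges between free vertices, so these
  edges conflict pairwise. In particular \<open>N\<^sub>2\<close> is independent, since an edge inside \<open>N\<^sub>2\<close> would not
  conflict with \<open>xy\<close>. Now let \<open>u, w \<in> N\<^sub>1\<close> be non-adjacent, both with neighbours in \<open>N\<^sub>2\<close>. Comparing
  the edges \<open>up\<close> (\<open>p \<in> N\<^sub>2\<close>) with the edge from \<open>w\<close> to \<open>x\<close> or \<open>y\<close>, and excluding induced 4-cycles,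
  shows that \<open>u\<close> and \<open>w\<close> have the same neighbours in \<open>N\<^sub>2\<close> (\<open>N2_nbhd_subset_of_nonadjacent\<close>); two
  common neighbours would again give an induced 4-cycle, so there is just one
  (\<open>nonadjacent_common_singleton\<close>). Hence the part of \<open>N\<^sub>1\<close> that has neighbours in \<open>N\<^sub>2\<close> is a clique
  up to vertices that send a single edge to \<open>N\<^sub>2\<close>. A clique of size \<open>k\<close> sends at most
  \<open>k (d - k) \<le> d\<^sup>2 / 4\<close> edges, and the exceptional vertices do not push the number
  above this bound unless all edges end at one vertex of \<open>N\<^sub>2\<close>, when there are at most \<open>d\<close> of them
  (\<open>sum_card_le_of_common_singletons\<close>). This is the first statement.

  For the second one, every edge lies in the conflict set of some \<open>e \<in> M\<close>, and an edge that lies in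
  only one of these conflict sets is private there. So the numbers \<open>|C(e)| + |PC(e)|\<close> sum to at least
  \<open>2 m(G)\<close> over \<open>e \<in> M\<close> (\<open>twice_num_edges_le\<close>), and it suffices that each of them is at most
  \<open>2 d\<^sup>2 + m(N\<^sub>1, N\<^sub>2)\<close> (\<open>card_conflict_sets_le\<close>). Edges inside the neighbourhood of \<open>xy\<close> may enlarge
  the private conflict set, but they lower the trivial bound on the conflict set by the same amount.
\<close>

section \<open>Edge conflicts\<close>

definition edges_conflict :: "'a graph \<Rightarrow> 'a set \<Rightarrow> 'a set \<Rightarrow> bool" where
  "edges_conflict G e f \<longleftrightarrow> (\<exists>u\<in>e. \<exists>v\<in>f. u = v \<or> {u, v} \<in> edges G)"

lemma edges_conflict_sym: "edges_conflict G e f \<Longrightarrow> edges_conflict G f e"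
  unfolding edges_conflict_def by (metis insert_commute)

lemma edges_conflict_self: "\<lbrakk>finite_simple_graph G; e \<in> edges G\<rbrakk> \<Longrightarrow> edges_conflict G e e"
  unfolding edges_conflict_def finite_simple_graph_def by (metis all_not_in_conv card.empty zero_neq_numeral)

lemma finite_edges: "finite_simple_graph G \<Longrightarrow> finite (edges G)"
  unfolding finite_simple_graph_def
  by (metis (no_types, lifting) Pow_iff finite_Pow_iff finite_subset subsetI)

lemma edgeE:
  assumes "finite_simple_graph G" "e \<in> edges G"
  obtains a b where "e = {a, b}" "a \<noteq> b"
  using assms unfolding finite_simple_graph_def by (metis card_2_iff)

lemma edge_endpoints_distinct: "\<lbrakk>finite_simple_graph G; {a, b} \<in> edges G\<rbrakk> \<Longrightarrow> a \<noteq> b"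
  unfolding finite_simple_graph_def by fastforce

lemma edge_eq_insert_endpoint:
  assumes "finite_simple_graph G" "e \<in> edges G" "a \<in> e"
  shows "\<exists>b. e = {a, b}"
proof -
  obtain p q where "e = {p, q}" using edgeE[OF assms(1,2)] .
  then show ?thesis using assms(3) by auto
qed

lemma finite_nbhd: "finite_simple_graph G \<Longrightarrow> finite (nbhd G u)"
  by (rule finite_subset[of _ "verts G"]) (auto simp: nbhd_def finite_simple_graph_def)

lemma degree_le_max_degree:
  assumes "finite_simple_graph G"
  shows "degree G v \<le> max_degree G"
proof (cases "v \<in> verts G")
  case True
  then show ?thesis
    using assms unfolding max_degree_def finite_simple_graph_def by (intro Max_ge) auto
next
  case False
  then have "nbhd G v = {}"
    using assms by (auto simp: nbhd_def finite_simple_graph_def)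
  then show ?thesis by (simp add: degree_def)
qed

text \<open>
  A walk of length at most 2 has at most one inner vertex, which turns the distance condition into a
  first-order one.
\<close>

lemma graph_dist_le_2_iff:
  "graph_dist L e f \<le> 2 \<longleftrightarrow>
     e = f \<or> {e, f} \<in> edges L \<or> (\<exists>g. {e, g} \<in> edges L \<and> {g, f} \<in> edges L)"
proof -
  let ?R = "{(a, b). {a, b} \<in> edges L}"
  have "graph_dist L e f \<le> 2 \<longleftrightarrow> (\<exists>n\<le>2. (e, f) \<in> ?R ^^ n)"
  proof
    assume le: "graph_dist L e f \<le> 2"
    show "\<exists>n\<le>2. (e, f) \<in> ?R ^^ n"
    proof (rule ccontr)
      assume "\<not> ?thesis"
      then have "3 \<le> n" if "(e, f) \<in> ?R ^^ n" for n
        using that by (metis Suc_leI not_le eval_nat_numeral(3))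
      then have "enat 3 \<le> graph_dist L e f"
        unfolding graph_dist_def by (auto intro!: INF_greatest)
      then have "enat 3 \<le> 2" using le by (rule order_trans)
      then show False by (simp add: numeral_eq_enat)
    qed
  next
    assume "\<exists>n\<le>2. (e, f) \<in> ?R ^^ n"
    then obtain n where "n \<le> 2" "(e, f) \<in> ?R ^^ n" by blast
    then have "graph_dist L e f \<le> enat n"
      unfolding graph_dist_def by (intro INF_lower) auto
    also have "enat n \<le> 2" using \<open>n \<le> 2\<close> by (simp add: numeral_eq_enat)
    finally show "graph_dist L e f \<le> 2" .
  qed
  also have "\<dots> \<longleftrightarrow> (e, f) \<in> ?R ^^ 0 \<or> (e, f) \<in> ?R ^^ 1 \<or> (e, f) \<in> ?R ^^ 2"
  proof -
    have "(\<exists>n\<le>2. P n) \<longleftrightarrow> P 0 \<or> P 1 \<or> P 2" for P :: "nat \<Rightarrow> bool"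
      by (auto simp: le_Suc_eq numeral_2_eq_2)
    then show ?thesis .
  qed
  also have "\<dots> \<longleftrightarrow> e = f \<or> {e, f} \<in> edges L \<or> (\<exists>g. {e, g} \<in> edges L \<and> {g, f} \<in> edges L)"
    by (auto simp: numeral_2_eq_2)
  finally show ?thesis .
qed

lemma line_graph_edge_iff:
  "{e, f} \<in> edges (line_graph G) \<longleftrightarrow> e \<in> edges G \<and> f \<in> edges G \<and> e \<noteq> f \<and> e \<inter> f \<noteq> {}"
  unfolding line_graph_def by (auto simp: doubleton_eq_iff)

text \<open>
  A path \<open>e, g, f\<close> in the line graph goes through an edge \<open>g\<close> that meets both \<open>e\<close> and \<open>f\<close>: either
  all three share a vertex or \<open>g\<close> joins \<open>e\<close> to \<open>f\<close>.
\<close>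

lemma conflict_set_iff:
  assumes G: "finite_simple_graph G" and e: "e \<in> edges G"
  shows "f \<in> conflict_set G e \<longleftrightarrow> f \<in> edges G \<and> edges_conflict G e f"
proof (cases "f \<in> edges G")
  case f: True
  have "graph_dist (line_graph G) e f \<le> 2 \<longleftrightarrow> edges_conflict G e f"
  proof
    assume "graph_dist (line_graph G) e f \<le> 2"
    then consider "e = f" | "e \<inter> f \<noteq> {}"
      | g where "g \<in> edges G" "e \<inter> g \<noteq> {}" "g \<inter> f \<noteq> {}"
      by (auto simp: graph_dist_le_2_iff line_graph_edge_iff)
    then show "edges_conflict G e f"
    proof cases
      case 1
      then show ?thesis using edges_conflict_self[OF G e] by simp
    next
      case 2
      then show ?thesis unfolding edges_conflict_def by blast
    next
      case 3
      then obtain u v where uv: "u \<in> e" "u \<in> g" "v \<in> g" "v \<in> f" by blast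
      obtain w where w: "g = {u, w}"
        using edge_eq_insert_endpoint[OF G 3(1) uv(2)] by blast
      then have "u = v \<or> {u, v} \<in> edges G" using uv 3(1) by auto
      then show ?thesis using uv(1,4) unfolding edges_conflict_def by blast
    qed
  next
    assume "edges_conflict G e f"
    then obtain u v where uv: "u \<in> e" "v \<in> f" "u = v \<or> {u, v} \<in> edges G"
      unfolding edges_conflict_def by blast
    show "graph_dist (line_graph G) e f \<le> 2"
    proof (cases "e \<inter> f = {}")
      case False
      then have "e = f \<or> {e, f} \<in> edges (line_graph G)"
        using e f by (simp add: line_graph_edge_iff)
      then show ?thesis by (subst graph_dist_le_2_iff) auto
    next
      case True
      then have "{u, v} \<in> edges G" "e \<noteq> {u, v}" "f \<noteq> {u, v}" using uv by auto
      then have "{e, {u, v}} \<in> edges (line_graph G)" "{{u, v}, f} \<in> edges (line_graph G)"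
        using e f uv(1,2) unfolding line_graph_edge_iff by auto
      then show ?thesis by (subst graph_dist_le_2_iff) (intro disjI2 exI conjI)
    qed
  qed
  then show ?thesis using f by (simp add: conflict_set_def)
qed (simp add: conflict_set_def)

lemma private_conflict_set_iff:
  assumes "finite_simple_graph G" "M \<subseteq> edges G" "e \<in> M"
  shows "f \<in> private_conflict_set G M e \<longleftrightarrow>
    f \<in> edges G \<and> edges_conflict G e f \<and> (\<forall>h\<in>M - {e}. \<not> edges_conflict G h f)"
proof -
  have c: "f \<in> conflict_set G h \<longleftrightarrow> f \<in> edges G \<and> edges_conflict G h f" if "h \<in> M" for h
    using conflict_set_iff[OF assms(1) subsetD[OF assms(2) that]] .
  show ?thesis
  proof
    assume "f \<in> private_conflict_set G M e"
    then have f: "f \<in> conflict_set G e" "\<And>h. h \<in> M - {e} \<Longrightarrow> f \<notin> conflict_set G h"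
      by (auto simp: private_conflict_set_def)
    show "f \<in> edges G \<and> edges_conflict G e f \<and> (\<forall>h\<in>M - {e}. \<not> edges_conflict G h f)"
    proof (intro conjI ballI)
      show E: "f \<in> edges G" "edges_conflict G e f" using f(1) c[OF assms(3)] by auto
      show "\<not> edges_conflict G h f" if "h \<in> M - {e}" for h
        using f(2)[OF that] c[of h] that E by auto
    qed
  next
    assume r: "f \<in> edges G \<and> edges_conflict G e f \<and> (\<forall>h\<in>M - {e}. \<not> edges_conflict G h f)"
    then have "f \<notin> conflict_set G h" if "h \<in> M - {e}" for h
      using c[of h] that by auto
    then show "f \<in> private_conflict_set G M e"
      using r c[OF assms(3)] by (simp add: private_conflict_set_def)
  qed
qed

text \<open>
  If \<open>uv\<close> witnesses a conflict of two matching edges, then \<open>u\<close> would have both \<open>v\<close> and its partner as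
  neighbours in the 1-regular subgraph.
\<close>

lemma induced_matching_iff:
  assumes G: "finite_simple_graph G"
  shows "induced_matching G M \<longleftrightarrow>
    M \<subseteq> edges G \<and> (\<forall>e\<in>M. \<forall>f\<in>M. e \<noteq> f \<longrightarrow> \<not> edges_conflict G e f)"
proof -
  have nb: "nbhd (induced_subgraph G S) v = {w. {v, w} \<in> edges G \<and> {v, w} \<subseteq> S}" for S v
    by (simp add: nbhd_def induced_subgraph_def)
  have vs: "verts (induced_subgraph G S) = S" for S
    by (simp add: induced_subgraph_def)
  show ?thesis
  proof
    assume im: "induced_matching G M"
    then have M: "M \<subseteq> edges G" by (simp add: induced_matching_def)
    have uniq: "w = w'"
      if "v \<in> \<Union>M" "w \<in> \<Union>M" "w' \<in> \<Union>M" "{v, w} \<in> edges G" "{v, w'} \<in> edges G" for v w w'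
    proof -
      have "card (nbhd (induced_subgraph G (\<Union>M)) v) = 1"
        using im that(1) unfolding induced_matching_def regular_def degree_def vs by blast
      then obtain z where z: "{w. {v, w} \<in> edges G \<and> {v, w} \<subseteq> \<Union>M} = {z}"
        unfolding nb by (rule card_1_singletonE)
      have "w \<in> {z}" "w' \<in> {z}"
        unfolding z[symmetric] using that by simp_all
      then show ?thesis by simp
    qed
    have "\<not> edges_conflict G e f" if ef: "e \<in> M" "f \<in> M" "e \<noteq> f" for e f
    proof
      assume "edges_conflict G e f"
      then obtain u v where uv: "u \<in> e" "v \<in> f" "u = v \<or> {u, v} \<in> edges G"
        unfolding edges_conflict_def by blast
      obtain u' where u': "e = {u, u'}"
        using edge_eq_insert_endpoint[OF G subsetD[OF M ef(1)] uv(1)] by blast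
      obtain v' where v': "f = {v, v'}"
        using edge_eq_insert_endpoint[OF G subsetD[OF M ef(2)] uv(2)] by blast
      have e: "{u, u'} \<in> edges G" and f: "{v, v'} \<in> edges G" using u' v' ef M by auto
      have inM: "u \<in> \<Union>M" "u' \<in> \<Union>M" "v \<in> \<Union>M" "v' \<in> \<Union>M" using ef u' v' by auto
      show False
      proof (cases "u = v")
        case True
        then have "u' = v'" using uniq inM e f by blast
        then show False using True u' v' ef by simp
      next
        case False
        then have uv': "{u, v} \<in> edges G" using uv by blast
        then have "v = u'" using uniq inM e by blast
        moreover have "u = v'" using uniq[of v] inM f uv' by (metis insert_commute)
        ultimately show False using u' v' ef by auto
      qed
    qed
    then show "M \<subseteq> edges G \<and> (\<forall>e\<in>M. \<forall>f\<in>M. e \<noteq> f \<longrightarrow> \<not> edges_conflict G e f)"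
      using M by blast
  next
    assume r: "M \<subseteq> edges G \<and> (\<forall>e\<in>M. \<forall>f\<in>M. e \<noteq> f \<longrightarrow> \<not> edges_conflict G e f)"
    have "card (nbhd (induced_subgraph G (\<Union>M)) v) = 1" if v: "v \<in> \<Union>M" for v
    proof -
      obtain e where e: "e \<in> M" "v \<in> e" using v by blast
      then have "e \<in> edges G" using r by blast
      then obtain w where w: "e = {v, w}" using edge_eq_insert_endpoint[OF G _ e(2)] by blast
      have "z = w" if z: "{v, z} \<in> edges G" "z \<in> \<Union>M" for z
      proof -
        obtain f where f: "f \<in> M" "z \<in> f" using z by blast
        then have "edges_conflict G e f" using z e unfolding edges_conflict_def by blast
        then have "e = f" using r e f by blast
        then show ?thesis using f w edge_endpoints_distinct[OF G z(1)] by auto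
      qed
      then have "{z. {v, z} \<in> edges G \<and> {v, z} \<subseteq> \<Union>M} = {w}"
        using e w r by blast
      then show ?thesis by (simp add: nb)
    qed
    then show "induced_matching G M"
      using r by (simp add: induced_matching_def regular_def degree_def vs)
  qed
qed

text \<open>
  The form in which the absence of induced 4-cycles is used: every 4-cycle has a chord.
\<close>

lemma C4_free_chord:
  assumes G: "finite_simple_graph G" and free: "C4_free G"
    and E: "{a, b} \<in> edges G" "{b, c} \<in> edges G" "{c, e} \<in> edges G" "{e, a} \<in> edges G"
    and ne: "a \<noteq> c" "b \<noteq> e"
  shows "{a, c} \<in> edges G \<or> {b, e} \<in> edges G"
proof (rule ccontr)
  assume no: "\<not> ?thesis"
  have d: "a \<noteq> b" "b \<noteq> c" "c \<noteq> e" "e \<noteq> a" using E edge_endpoints_distinct[OF G] by blast+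
  let ?S = "{a, b, c, e}"
  define f :: "'a \<Rightarrow> nat" where
    "f = (\<lambda>v. if v = a then 0 else if v = b then 1 else if v = c then 2 else 3)"
  have f: "f a = 0" "f b = 1" "f c = 2" "f e = 3" using d ne by (auto simp: f_def)
  have S: "?S \<subseteq> verts G" using G E unfolding finite_simple_graph_def by blast
  have "{h \<in> edges G. h \<subseteq> ?S} = {{a, b}, {b, c}, {c, e}, {e, a}}"
  proof
    show "{{a, b}, {b, c}, {c, e}, {e, a}} \<subseteq> {h \<in> edges G. h \<subseteq> ?S}" using E by auto
    show "{h \<in> edges G. h \<subseteq> ?S} \<subseteq> {{a, b}, {b, c}, {c, e}, {e, a}}"
    proof
      fix h assume "h \<in> {h \<in> edges G. h \<subseteq> ?S}"
      then have h: "h \<in> edges G" "h \<subseteq> ?S" by auto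
      obtain p q where pq: "h = {p, q}" "p \<noteq> q" using edgeE[OF G h(1)] .
      have "p \<in> ?S" "q \<in> ?S" using pq h by auto
      moreover have "h \<noteq> {a, c}" "h \<noteq> {b, e}" using no h by auto
      ultimately show "h \<in> {{a, b}, {b, c}, {c, e}, {e, a}}"
        using pq(2) unfolding pq(1) by (auto simp: doubleton_eq_iff)
    qed
  qed
  then have "(\<lambda>h. f ` h) ` edges (induced_subgraph G ?S) = edges C4"
    by (simp add: induced_subgraph_def C4_def f)
  moreover have "bij_betw f (verts (induced_subgraph G ?S)) (verts C4)"
    using d ne f by (auto simp: bij_betw_def inj_on_def induced_subgraph_def C4_def)
  ultimately show False
    using free S unfolding C4_free_def isomorphic_def by blast
qed

section \<open>Local optimality\<close>

text \<open>
  All that the proof needs to know about a matching returned by Local Search. The degree bound ranges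
  over all elements of the type, since an element outside the vertex set has no neighbours.
\<close>

locale locally_optimal_matching =
  fixes G :: "'a graph" and d :: nat and M :: "'a set set"
  assumes simple: "finite_simple_graph G"
    and C4_free: "C4_free G"
    and degree_le: "degree G v \<le> d"
    and M_edges: "M \<subseteq> edges G"
    and M_separated: "\<lbrakk>e \<in> M; f \<in> M; e \<noteq> f\<rbrakk> \<Longrightarrow> \<not> edges_conflict G e f"
    and M_dominating: "f \<in> edges G \<Longrightarrow> \<exists>e\<in>M. edges_conflict G e f"
    and private_edges_conflict:
      "\<lbrakk>e \<in> M; f \<in> private_conflict_set G M e; h \<in> private_conflict_set G M e\<rbrakk>
        \<Longrightarrow> edges_conflict G f h"

lemma ls_choose_cases:
  assumes "ls_choose R A B"
  obtains "R = {}" "B = A" | "B \<in> R"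
  using assms unfolding ls_choose_def by (auto split: if_splits)

lemma ls_add_results_card:
  assumes "finite A" "B \<in> ls_add_results G A"
  shows "induced_matching G B \<and> card B = Suc (card A)"
  using assms unfolding ls_add_results_def by auto

lemma ls_swap_results_card:
  assumes "finite A" "B \<in> ls_swap_results G A"
  shows "induced_matching G B \<and> card B = Suc (card A)"
proof -
  obtain e e' e'' where e: "B = (A - {e}) \<union> {e', e''}" "e \<in> A" "e' \<notin> A" "e'' \<notin> A" "e' \<noteq> e''"
    "induced_matching G B"
    using assms(2) unfolding ls_swap_results_def by auto
  have "card B = card (A - {e}) + card {e', e''}"
    unfolding e(1) using e assms(1) by (intro card_Un_disjoint) auto
  also have "card (A - {e}) = card A - 1" using e(2) by simp
  also have "card {e', e''} = 2" using e(5) by simp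
  also have "card A - 1 + 2 = Suc (card A)"
    using e(2) assms(1) card_gt_0_iff[of A] by auto
  finally show ?thesis using e(6) by simp
qed

lemma finite_induced_matching:
  "\<lbrakk>finite_simple_graph G; induced_matching G A\<rbrakk> \<Longrightarrow> finite A"
  unfolding induced_matching_def using finite_edges finite_subset by blast

text \<open>
  Either half of an iteration enlarges the matching by one edge unless it is inapplicable, so an
  iteration without growth certifies that the matching it started from admits neither move.
\<close>

lemma ls_iteration_cases:
  assumes G: "finite_simple_graph G" and A: "induced_matching G A" and it: "ls_iteration G A B"
  shows "induced_matching G B \<and>
    (card A < card B \<or> B = A \<and> ls_add_results G A = {} \<and> ls_swap_results G A = {})"
proof -
  obtain A' where A': "ls_choose (ls_add_results G A) A A'" "ls_choose (ls_swap_results G A') A' B"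
    using it unfolding ls_iteration_def by blast
  have fin: "finite C" if "induced_matching G C" for C
    using finite_induced_matching[OF G that] .
  from A'(1) have 1: "induced_matching G A' \<and>
      (card A < card A' \<or> A' = A \<and> ls_add_results G A = {})"
    by (cases rule: ls_choose_cases) (use A fin ls_add_results_card in \<open>fastforce+\<close>)
  from A'(2) have "induced_matching G B \<and>
      (card A' < card B \<or> B = A' \<and> ls_swap_results G A' = {})"
    by (cases rule: ls_choose_cases) (use 1 fin ls_swap_results_card in \<open>fastforce+\<close>)
  with 1 show ?thesis by auto
qed

lemma local_search_output_optimal:
  assumes G: "finite_simple_graph G" and out: "local_search_output G M"
  shows "induced_matching G M" "ls_add_results G M = {}" "ls_swap_results G M = {}"
proof -
  obtain M0 where run: "(\<lambda>A B. ls_iteration G A B \<and> card A < card B)\<^sup>*\<^sup>* {} M0"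
    and last: "ls_iteration G M0 M" "\<not> card M0 < card M"
    using out unfolding local_search_output_def by blast
  have "induced_matching G M0"
    using run
  proof (induction rule: rtranclp_induct)
    case base
    show ?case by (simp add: induced_matching_iff[OF G])
  next
    case (step B C)
    then show ?case using ls_iteration_cases[OF G] by blast
  qed
  then show "induced_matching G M" "ls_add_results G M = {}" "ls_swap_results G M = {}"
    using ls_iteration_cases[OF G _ last(1)] last(2) by auto
qed

lemma local_search_output_locally_optimal:
  assumes G: "finite_simple_graph G" and "C4_free G" and "max_degree G \<le> d"
    and out: "local_search_output G M"
  shows "locally_optimal_matching G d M"
proof
  note opt = local_search_output_optimal[OF G out]
  note im = induced_matching_iff[OF G]
  show "finite_simple_graph G" "C4_free G" by fact+
  show "degree G v \<le> d" for v
    using degree_le_max_degree[OF G, of v] assms(3) by linarith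
  show M: "M \<subseteq> edges G" using opt(1) im by blast
  show sep: "\<not> edges_conflict G e f" if "e \<in> M" "f \<in> M" "e \<noteq> f" for e f
    using opt(1) im that by blast
  show "\<exists>e\<in>M. edges_conflict G e f" if f: "f \<in> edges G" for f
  proof (rule ccontr)
    assume no: "\<not> ?thesis"
    then have "f \<notin> M" using edges_conflict_self[OF G f] by blast
    moreover have "induced_matching G (M \<union> {f})"
      unfolding im using M sep no f edges_conflict_sym by blast
    ultimately show False using opt(2) f unfolding ls_add_results_def by blast
  qed
  show "edges_conflict G f h"
    if e: "e \<in> M" and "f \<in> private_conflict_set G M e" "h \<in> private_conflict_set G M e" for e f h
  proof (rule ccontr)
    assume no: "\<not> ?thesis"
    have f: "f \<in> edges G" "edges_conflict G e f" "\<And>k. k \<in> M - {e} \<Longrightarrow> \<not> edges_conflict G k f"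
      and h: "h \<in> edges G" "edges_conflict G e h" "\<And>k. k \<in> M - {e} \<Longrightarrow> \<not> edges_conflict G k h"
      using that by (simp_all add: private_conflict_set_iff[OF G M e])
    have "f \<noteq> h" using no edges_conflict_self[OF G f(1)] by blast
    have "f \<noteq> e" "h \<noteq> e" using no f h edges_conflict_sym by blast+
    then have "f \<notin> M" "h \<notin> M" using f h edges_conflict_self[OF G] by blast+
    have "M - {e} \<union> {f, h} \<subseteq> edges G" using M f h by blast
    moreover have "\<not> edges_conflict G p q"
      if "p \<in> M - {e} \<union> {f, h}" "q \<in> M - {e} \<union> {f, h}" "p \<noteq> q" for p q
      using that sep[of p q] f(3)[of p] f(3)[of q] h(3)[of p] h(3)[of q] no
        edges_conflict_sym[of G p q] edges_conflict_sym[of G q p]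
      by blast
    ultimately have "induced_matching G (M - {e} \<union> {f, h})"
      unfolding im by blast
    then show False
      using opt(3) e f(1) h(1) \<open>f \<notin> M\<close> \<open>h \<notin> M\<close> \<open>f \<noteq> h\<close> unfolding ls_swap_results_def by blast
  qed
qed

section \<open>Edges leaving an almost complete set\<close>

text \<open>
  The difference of the two sides is \<open>(k - j)\<^sup>2 + q\<^sup>2 + 2 q (k + j - 2)\<close>.
\<close>

lemma four_mult_add_le_square:
  fixes q k j :: int
  assumes "q \<ge> 0" "k \<ge> 1" "j \<ge> 1"
  shows "4 * (q + k * j) \<le> (q + k + j)\<^sup>2"
proof -
  have "(q + k + j)\<^sup>2 - 4 * (q + k * j) = (k - j)\<^sup>2 + q\<^sup>2 + 2 * (q * (k + j - 2))"
    by (simp add: power2_eq_square algebra_simps)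
  also have "\<dots> \<ge> 0" using assms by (intro add_nonneg_nonneg mult_nonneg_nonneg) auto
  finally show ?thesis by simp
qed

text \<open>
  Here \<open>A\<close> stands for the vertices of \<open>N\<^sub>1\<close> with a neighbour in \<open>N\<^sub>2\<close>, and \<open>b u\<close> for the set of these
  neighbours; the summand 1 in the degree bound is the edge to \<open>x\<close> or \<open>y\<close>. Split \<open>A\<close> into the set
  \<open>D\<close> of elements that have a non-neighbour in \<open>A\<close>, each of which contributes 1 to the sum, and the
  rest \<open>K\<close>, whose elements are adjacent to all others in \<open>A\<close> and hence contribute at most \<open>j = d - |A|\<close>. If
  \<open>K\<close> is non-empty, then \<open>j \<ge> 1\<close> and the sum is at most \<open>|D| + |K| j\<close> where \<open>d = |D| + |K| + j\<close>. If
  \<open>K\<close> is empty, the sum is \<open>|A|\<close>. It is at most \<open>d\<close> when all singletons \<open>b u\<close> agree. Otherwise two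
  classes of elements with equal singletons are disjoint, so the smaller one has at most \<open>|A| / 2\<close>
  elements; its elements are adjacent to everything outside the class, which forces
  \<open>|A| + 4 \<le> 2 d\<close>, and \<open>8 d - 16 \<le> d\<^sup>2\<close>.
\<close>

lemma sum_card_le_of_common_singletons:
  fixes A :: "'a set" and b :: "'a \<Rightarrow> 'b set" and adj :: "'a \<Rightarrow> 'a \<Rightarrow> bool" and d :: nat
  assumes A: "finite A"
    and fin: "\<And>u. u \<in> A \<Longrightarrow> finite (b u)"
    and ne: "\<And>u. u \<in> A \<Longrightarrow> b u \<noteq> {}"
    and deg: "\<And>u. u \<in> A \<Longrightarrow> card {w \<in> A. w \<noteq> u \<and> adj u w} + card (b u) + 1 \<le> d"
    and codeg: "\<And>v. card {u \<in> A. v \<in> b u} \<le> d"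
    and nonadj: "\<And>u w. \<lbrakk>u \<in> A; w \<in> A; w \<noteq> u; \<not> adj u w\<rbrakk> \<Longrightarrow> \<exists>v. b u = {v} \<and> b w = {v}"
  shows "(\<Sum>u\<in>A. card (b u)) \<le> d \<or> 4 * (\<Sum>u\<in>A. card (b u)) \<le> d\<^sup>2"
proof -
  let ?m = "\<Sum>u\<in>A. card (b u)"
  define D where "D = {u \<in> A. \<exists>w\<in>A. w \<noteq> u \<and> \<not> adj u w}"
  define K where "K = A - D"
  have AK: "A = D \<union> K" "D \<inter> K = {}" "finite D" "finite K"
    using A by (auto simp: D_def K_def)
  have cA: "card A = card D + card K"
    using AK by (simp add: card_Un_disjoint)
  have D1: "card (b u) = 1" if "u \<in> D" for u
    using that nonadj unfolding D_def by fastforce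
  have KA: "card (b u) + card A \<le> d" if u: "u \<in> K" for u
  proof -
    have "{w \<in> A. w \<noteq> u \<and> adj u w} = A - {u}" using u by (auto simp: K_def D_def)
    moreover have "card (A - {u}) + 1 = card A"
      using A u by (metis K_def DiffD1 Suc_eq_plus1 card_Suc_Diff1)
    ultimately show ?thesis using deg[of u] u by (simp add: K_def)
  qed
  have m: "?m = card D + (\<Sum>u\<in>K. card (b u))"
    using AK D1 by (simp add: sum.union_disjoint)
  show ?thesis
  proof (cases "K = {}")
    case False
    then obtain u where u: "u \<in> K" by blast
    then have "card (b u) > 0" using fin ne by (simp add: K_def card_gt_0_iff)
    then have lt: "card A < d" using KA[OF u] by linarith
    define j where "j = d - card A"
    have "card (b w) \<le> j" if "w \<in> K" for w using KA[OF that] by (simp add: j_def)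
    then have le: "?m \<le> card D + card K * j"
      unfolding m using sum_bounded_above[of K "\<lambda>w. card (b w)" j] by simp
    have d: "d = card D + card K + j" "j \<ge> 1" using lt cA by (auto simp: j_def)
    have k: "card K \<ge> 1" using False AK by (simp add: Suc_leI card_gt_0_iff)
    have "int (4 * (card D + card K * j)) \<le> int (d\<^sup>2)"
      using four_mult_add_le_square[of "int (card D)" "int (card K)" "int j"] d k by simp
    then have "4 * (card D + card K * j) \<le> d\<^sup>2"
      by (simp only: of_nat_le_iff)
    moreover have "4 * ?m \<le> 4 * (card D + card K * j)" using le by (rule mult_le_mono2)
    ultimately show ?thesis using order_trans by blast
  next
    case True
    then have mA: "?m = card A" and DA: "D = A" using m cA AK by auto
    have single: "\<exists>v. b u = {v}" if "u \<in> A" for u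
      using D1 that DA by (metis card_1_singletonE)
    show ?thesis
    proof (cases "\<exists>v. \<forall>u\<in>A. b u = {v}")
      case True
      then obtain v where "\<forall>u\<in>A. b u = {v}" by blast
      then have "{u \<in> A. v \<in> b u} = A" by auto
      then show ?thesis using codeg[of v] mA by simp
    next
      case False
      then obtain u where u: "u \<in> A" by blast
      with False single obtain w where w: "w \<in> A" "b w \<noteq> b u" by metis
      \<comment> \<open>The degree bound at \<open>t\<close> covers \<open>A\<close> without the class of \<open>t\<close>, the element of \<open>b t\<close>, and 1 more.\<close>
      have class_bound: "card A + 2 \<le> d + card {z \<in> A. b z = b t}" if t: "t \<in> A" for t
      proof -
        have "A \<subseteq> {z \<in> A. b z = b t} \<union> {z \<in> A. z \<noteq> t \<and> adj t z}"
          using nonadj[OF t] by fastforce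
        then have "card A \<le> card ({z \<in> A. b z = b t} \<union> {z \<in> A. z \<noteq> t \<and> adj t z})"
          using A by (intro card_mono) auto
        also have "\<dots> \<le> card {z \<in> A. b z = b t} + card {z \<in> A. z \<noteq> t \<and> adj t z}"
          by (rule card_Un_le)
        finally show ?thesis using deg[OF t] D1[of t] DA t by simp
      qed
      have "card {z \<in> A. b z = b u} + card {z \<in> A. b z = b w}
          = card ({z \<in> A. b z = b u} \<union> {z \<in> A. b z = b w})"
        using A w by (intro card_Un_disjoint[symmetric]) auto
      also have "\<dots> \<le> card A" using A by (intro card_mono) auto
      finally have "card A + 4 \<le> 2 * d" using class_bound[OF u] class_bound[OF w(1)] by linarith
      then have "4 * int (card A) + 16 \<le> 8 * int d" by linarith
      \<comment> \<open>This is \<open>8 d - 16 \<le> d\<^sup>2\<close>.\<close>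
      moreover have "0 \<le> (int d - 4)\<^sup>2" by simp
      ultimately have "4 * int (card A) \<le> (int d)\<^sup>2"
        by (simp add: power2_eq_square algebra_simps)
      then have "4 * card A \<le> d\<^sup>2"
        by (metis (mono_tags, lifting) of_nat_mult of_nat_numeral of_nat_power of_nat_le_iff)
      then show ?thesis using mA by simp
    qed
  qed
qed

section \<open>The private conflict set of one matching edge\<close>

locale locally_optimal_matching_edge = locally_optimal_matching +
  fixes x y :: 'a
  assumes xy: "{x, y} \<in> M"
begin

definition free_verts :: "'a set" where
  "free_verts = {z. \<forall>f\<in>M - {{x, y}}. \<forall>w\<in>f. w \<noteq> z \<and> {w, z} \<notin> edges G}"

definition N1 :: "'a set" where
  "N1 = {v \<in> (nbhd G x \<union> nbhd G y) - {x, y}. \<exists>e\<in>private_conflict_set G M {x, y}. v \<in> e}"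

definition N2 :: "'a set" where
  "N2 = {v \<in> verts G - (closed_nbhd G x \<union> closed_nbhd G y).
           \<exists>e\<in>private_conflict_set G M {x, y}. v \<in> e}"

lemma xy_edge: "{x, y} \<in> edges G"
  using xy M_edges by blast

text \<open>
  An edge between free vertices conflicts with no edge of \<open>M\<close> other than \<open>xy\<close>, and since it must
  conflict with some edge of \<open>M\<close>, it conflicts with \<open>xy\<close>.
\<close>

lemma private_conflict_set_eq: "private_conflict_set G M {x, y} = {e \<in> edges G. e \<subseteq> free_verts}"
proof (rule set_eqI)
  fix e
  have far: "(\<forall>h\<in>M - {{x, y}}. \<not> edges_conflict G h e) \<longleftrightarrow> e \<subseteq> free_verts"
    unfolding free_verts_def edges_conflict_def by blast
  have "edges_conflict G {x, y} e" if "e \<in> edges G" "e \<subseteq> free_verts"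
    using M_dominating[OF that(1)] that(2) far by blast
  then show "e \<in> private_conflict_set G M {x, y} \<longleftrightarrow> e \<in> {e \<in> edges G. e \<subseteq> free_verts}"
    unfolding private_conflict_set_iff[OF simple M_edges xy] using far by blast
qed

lemma free_edge_conflicts:
  assumes "{a, b} \<in> edges G" "a \<in> free_verts" "b \<in> free_verts"
  shows "edges_conflict G {x, y} {a, b}"
proof -
  have "{a, b} \<in> private_conflict_set G M {x, y}"
    using assms by (simp add: private_conflict_set_eq)
  then show ?thesis
    by (simp add: private_conflict_set_iff[OF simple M_edges xy])
qed

lemma free_edges_conflict:
  assumes "{a, b} \<in> edges G" "{a', b'} \<in> edges G" "a \<in> free_verts" "b \<in> free_verts"
    "a' \<in> free_verts" "b' \<in> free_verts"
  shows "edges_conflict G {a, b} {a', b'}"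
  using private_edges_conflict[OF xy, of "{a, b}" "{a', b'}"] assms
  by (simp add: private_conflict_set_eq)

lemma endpoints_free: "x \<in> free_verts" "y \<in> free_verts"
proof -
  have "{x, y} \<in> private_conflict_set G M {x, y}"
    using M_separated xy xy_edge edges_conflict_self[OF simple xy_edge]
    by (auto simp: private_conflict_set_iff[OF simple M_edges xy])
  then show "x \<in> free_verts" "y \<in> free_verts" by (simp_all add: private_conflict_set_eq)
qed

lemma N1_free: "N1 \<subseteq> free_verts" and N2_free: "N2 \<subseteq> free_verts"
  unfolding N1_def N2_def private_conflict_set_eq by blast+

lemma N2_not_near:
  assumes "v \<in> N2"
  shows "v \<noteq> x" "v \<noteq> y" "{x, v} \<notin> edges G" "{y, v} \<notin> edges G"
  using assms by (auto simp: N2_def closed_nbhd_def nbhd_def)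

text \<open>
  All vertices of \<open>N\<^sub>2\<close> are free, so an edge inside \<open>N\<^sub>2\<close> would have to conflict with \<open>xy\<close>.
\<close>

lemma N2_independent:
  assumes "v \<in> N2" "w \<in> N2"
  shows "{v, w} \<notin> edges G"
proof
  assume "{v, w} \<in> edges G"
  then have "edges_conflict G {x, y} {v, w}" using free_edge_conflicts assms N2_free by blast
  then show False
    using N2_not_near[OF assms(1)] N2_not_near[OF assms(2)] unfolding edges_conflict_def by auto
qed

lemma N1_N2_disjoint: "N1 \<inter> N2 = {}"
  by (auto simp: N1_def N2_def closed_nbhd_def)

definition N2_nbhd :: "'a \<Rightarrow> 'a set" where
  "N2_nbhd u = nbhd G u \<inter> N2"

text \<open>
  Let \<open>p \<in> N\<^sub>2\<close> be a neighbour of \<open>u\<close> but not of \<open>w\<close>, let \<open>q \<in> N\<^sub>2\<close> be a neighbour of \<open>w\<close>, and let \<open>z\<close> be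
  a neighbour of \<open>w\<close> among \<open>x\<close> and \<open>y\<close>. The edges \<open>zw\<close> and \<open>up\<close> conflict, which is only possible
  through an edge \<open>zu\<close>; the edges \<open>wq\<close> and \<open>up\<close> conflict, which is only possible through an edge
  \<open>qu\<close>. Then \<open>z, w, q, u\<close> is a 4-cycle without chords.
\<close>

lemma N2_nbhd_subset_of_nonadjacent:
  assumes u: "u \<in> N1" and w: "w \<in> N1" and nadj: "u \<noteq> w" "{u, w} \<notin> edges G"
    and "N2_nbhd w \<noteq> {}"
  shows "N2_nbhd u \<subseteq> N2_nbhd w"
proof
  fix p assume "p \<in> N2_nbhd u"
  then have p: "{u, p} \<in> edges G" "p \<in> N2" by (auto simp: N2_nbhd_def nbhd_def)
  obtain q where q: "{w, q} \<in> edges G" "q \<in> N2" using assms(5) by (auto simp: N2_nbhd_def nbhd_def)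
  obtain z where z: "z = x \<or> z = y" "{z, w} \<in> edges G" using w by (auto simp: N1_def nbhd_def)
  have z_free: "z \<in> free_verts" using z endpoints_free by blast
  have uxy: "u \<noteq> z" using u z by (auto simp: N1_def)
  have ne: "u \<noteq> q" "w \<noteq> p" using u w p q N1_N2_disjoint by blast+
  have zp: "z \<noteq> p" "{z, p} \<notin> edges G" and zq: "z \<noteq> q" "{z, q} \<notin> edges G"
    using z N2_not_near p(2) q(2) by metis+
  have free: "u \<in> free_verts" "w \<in> free_verts" "p \<in> free_verts" "q \<in> free_verts"
    using u w p q N1_free N2_free by blast+
  have "{w, p} \<in> edges G"
  proof (rule ccontr)
    assume no: "{w, p} \<notin> edges G"
    have "edges_conflict G {z, w} {u, p}" using free_edges_conflict z p free z_free by blast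
    then have zu: "{z, u} \<in> edges G"
      using no nadj ne uxy zp unfolding edges_conflict_def by (auto simp: insert_commute)
    have "edges_conflict G {w, q} {u, p}" using free_edges_conflict q p free by blast
    then have "{q, u} \<in> edges G"
      using no nadj ne q(1) N2_independent[OF q(2) p(2)] unfolding edges_conflict_def
      by (auto simp: insert_commute)
    then have "{z, q} \<in> edges G \<or> {w, u} \<in> edges G"
      using C4_free_chord[OF simple C4_free z(2) q(1), of u] zu zq nadj by (metis insert_commute)
    then show False using zq nadj by (auto simp: insert_commute)
  qed
  then show "p \<in> N2_nbhd w" using p by (simp add: N2_nbhd_def nbhd_def)
qed

text \<open>
  Two common neighbours in the independent set \<open>N\<^sub>2\<close> would close an induced 4-cycle with \<open>u\<close> and \<open>w\<close>.
\<close>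

lemma nonadjacent_common_singleton:
  assumes u: "u \<in> N1" and w: "w \<in> N1" and nadj: "u \<noteq> w" "{u, w} \<notin> edges G"
    and ne: "N2_nbhd u \<noteq> {}" "N2_nbhd w \<noteq> {}"
  shows "\<exists>v. N2_nbhd u = {v} \<and> N2_nbhd w = {v}"
proof -
  have eq: "N2_nbhd u = N2_nbhd w"
    using N2_nbhd_subset_of_nonadjacent[OF u w nadj ne(2)]
      N2_nbhd_subset_of_nonadjacent[OF w u _ _ ne(1)] nadj
    by (metis insert_commute subset_antisym)
  have "p = q" if "p \<in> N2_nbhd u" "q \<in> N2_nbhd u" for p q
  proof (rule ccontr)
    assume "p \<noteq> q"
    have "{u, p} \<in> edges G" "{p, w} \<in> edges G" "{w, q} \<in> edges G" "{q, u} \<in> edges G"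
      using that eq by (auto simp: N2_nbhd_def nbhd_def insert_commute)
    then have "{u, w} \<in> edges G \<or> {p, q} \<in> edges G"
      using C4_free_chord[OF simple C4_free] nadj \<open>p \<noteq> q\<close> by blast
    then show False using nadj N2_independent that by (auto simp: N2_nbhd_def)
  qed
  then show ?thesis using eq ne by blast
qed

lemma finite_N1_N2: "finite N1" "finite N2"
proof -
  show "finite N1"
    by (rule finite_subset[of _ "nbhd G x \<union> nbhd G y"]) (auto simp: N1_def finite_nbhd[OF simple])
  show "finite N2"
    by (rule finite_subset[of _ "verts G"]) (use simple in \<open>auto simp: N2_def finite_simple_graph_def\<close>)
qed

lemma num_edges_between_le:
  "num_edges_between G N1 N2 \<le> d \<or> 4 * num_edges_between G N1 N2 \<le> d\<^sup>2"
proof -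
  define A where "A = {u \<in> N1. N2_nbhd u \<noteq> {}}"
  have finA: "finite A" and finb: "finite (N2_nbhd u)" for u
    using finite_N1_N2 by (auto simp: A_def N2_nbhd_def)
  have "{e \<in> edges G. \<exists>u\<in>N1. \<exists>v\<in>N2. e = {u, v}} \<subseteq> (\<Union>u\<in>A. (\<lambda>v. {u, v}) ` N2_nbhd u)"
    by (fastforce simp: A_def N2_nbhd_def nbhd_def)
  then have "num_edges_between G N1 N2 \<le> card (\<Union>u\<in>A. (\<lambda>v. {u, v}) ` N2_nbhd u)"
    unfolding num_edges_between_def using finA finb by (intro card_mono) auto
  also have "\<dots> \<le> (\<Sum>u\<in>A. card ((\<lambda>v. {u, v}) ` N2_nbhd u))"
    by (rule card_UN_le[OF finA])
  also have "\<dots> \<le> (\<Sum>u\<in>A. card (N2_nbhd u))"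
    by (intro sum_mono card_image_le finb)
  finally have le: "num_edges_between G N1 N2 \<le> (\<Sum>u\<in>A. card (N2_nbhd u))" .
  have "(\<Sum>u\<in>A. card (N2_nbhd u)) \<le> d \<or> 4 * (\<Sum>u\<in>A. card (N2_nbhd u)) \<le> d\<^sup>2"
  proof (rule sum_card_le_of_common_singletons[where adj = "\<lambda>u w. {u, w} \<in> edges G"])
    show "finite A" by (rule finA)
    show "finite (N2_nbhd u)" "N2_nbhd u \<noteq> {}" if "u \<in> A" for u
      using that finb by (auto simp: A_def)
    show "card {w \<in> A. w \<noteq> u \<and> {u, w} \<in> edges G} + card (N2_nbhd u) + 1 \<le> d" if u: "u \<in> A" for u
    proof -
      let ?W = "{w \<in> A. w \<noteq> u \<and> {u, w} \<in> edges G}"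
      have "u \<in> nbhd G x \<union> nbhd G y" using u by (simp add: A_def N1_def)
      then obtain z where z: "z = x \<or> z = y" "{z, u} \<in> edges G"
        unfolding nbhd_def by blast
      then have uz: "{u, z} \<in> edges G" by (simp add: insert_commute)
      have finW: "finite ?W" by (rule finite_subset[OF _ finA]) auto
      have zb: "z \<notin> ?W \<union> N2_nbhd u"
        using z N2_not_near by (auto simp: A_def N1_def N2_nbhd_def)
      have "card ?W + card (N2_nbhd u) = card (?W \<union> N2_nbhd u)"
        using finb finW N1_N2_disjoint
        by (intro card_Un_disjoint[symmetric]) (auto simp: A_def N2_nbhd_def)
      then have "card ?W + card (N2_nbhd u) + 1 = card (insert z (?W \<union> N2_nbhd u))"
        using zb finW finb by simp
      also have "\<dots> \<le> card (nbhd G u)"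
        using uz by (intro card_mono finite_nbhd[OF simple]) (auto simp: nbhd_def N2_nbhd_def)
      also have "\<dots> \<le> d" using degree_le[of u] by (simp add: degree_def)
      finally show ?thesis .
    qed
    show "card {u \<in> A. v \<in> N2_nbhd u} \<le> d" for v
    proof -
      have "card {u \<in> A. v \<in> N2_nbhd u} \<le> card (nbhd G v)"
        by (intro card_mono finite_nbhd[OF simple]) (auto simp: N2_nbhd_def nbhd_def insert_commute)
      then show ?thesis using degree_le[of v] by (simp add: degree_def)
    qed
    show "\<exists>v. N2_nbhd u = {v} \<and> N2_nbhd w = {v}"
      if "u \<in> A" "w \<in> A" "w \<noteq> u" "{u, w} \<notin> edges G" for u w
      using that nonadjacent_common_singleton[of u w] by (auto simp: A_def)
  qed
  moreover have "4 * num_edges_between G N1 N2 \<le> 4 * (\<Sum>u\<in>A. card (N2_nbhd u))"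
    using le by (rule mult_le_mono2)
  ultimately show ?thesis using le order_trans by blast
qed

end

section \<open>Sizes of conflict sets\<close>

text \<open>
  Summing degrees over \<open>U\<close> counts an edge once for each of its ends in \<open>U\<close>.
\<close>

lemma sum_degree_eq:
  assumes G: "finite_simple_graph G" and U: "finite U"
  shows "(\<Sum>u\<in>U. degree G u) =
    card {e \<in> edges G. e \<inter> U \<noteq> {}} + card {e \<in> edges G. e \<subseteq> U}"
proof -
  note finE = finite_edges[OF G]
  have deg: "degree G u = (\<Sum>e\<in>edges G. if u \<in> e then 1 else 0)" for u
  proof -
    have "bij_betw (\<lambda>v. {u, v}) (nbhd G u) {e \<in> edges G. u \<in> e}"
      unfolding bij_betw_def
    proof
      show "inj_on (\<lambda>v. {u, v}) (nbhd G u)" by (auto simp: inj_on_def doubleton_eq_iff)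
      show "(\<lambda>v. {u, v}) ` nbhd G u = {e \<in> edges G. u \<in> e}"
        using edge_eq_insert_endpoint[OF G, of _ u] by (auto simp: nbhd_def)
    qed
    then have "degree G u = card {e \<in> edges G. u \<in> e}"
      unfolding degree_def by (rule bij_betw_same_card)
    then show ?thesis using finE by (simp add: sum.If_cases Int_def)
  qed
  have "(\<Sum>u\<in>U. degree G u) = (\<Sum>e\<in>edges G. \<Sum>u\<in>U. if u \<in> e then 1 else 0)"
    unfolding deg by (rule sum.swap)
  also have "\<dots> = (\<Sum>e\<in>edges G. (if e \<inter> U \<noteq> {} then 1 else 0) + (if e \<subseteq> U then 1 else 0))"
  proof (rule sum.cong[OF refl])
    fix e assume "e \<in> edges G"
    then obtain p q where pq: "e = {p, q}" "p \<noteq> q" using edgeE[OF G] by metis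
    have "(\<Sum>u\<in>U. if u \<in> e then 1 else 0) = card (U \<inter> e)"
      using U by (simp add: sum.If_cases)
    also have "\<dots> = (if e \<inter> U \<noteq> {} then 1 else 0) + (if e \<subseteq> U then 1 else 0)"
      using pq by (cases "p \<in> U"; cases "q \<in> U") auto
    finally show "(\<Sum>u\<in>U. if u \<in> e then 1 else 0)
      = (if e \<inter> U \<noteq> {} then 1 else 0) + (if e \<subseteq> U then 1 else (0::nat))" .
  qed
  also have "\<dots> = card {e \<in> edges G. e \<inter> U \<noteq> {}} + card {e \<in> edges G. e \<subseteq> U}"
    using finE by (simp add: sum.distrib sum.If_cases Int_def)
  finally show ?thesis .
qed

context locally_optimal_matching_edge
begin

text \<open>
  Let \<open>U\<close> be the set of neighbours of \<open>x\<close> and \<open>y\<close> outside \<open>{x, y}\<close>, so \<open>|U| \<le> 2 (d - 1)\<close>. Every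
  conflicting edge except \<open>xy\<close> meets \<open>U\<close>, and by \<open>sum_degree_eq\<close> there are at most \<open>d |U| - m(U)\<close>
  edges that do. A private edge is \<open>xy\<close> itself, one of at most \<open>2 (d - 1)\<close> edges from \<open>{x, y}\<close>
  to \<open>U\<close>, an edge inside \<open>U\<close>, or an edge between \<open>N\<^sub>1\<close> and \<open>N\<^sub>2\<close>. In the sum of the two bounds the
  term \<open>m(U)\<close> cancels, and \<open>2 + 2 (d - 1) (d + 1) = 2 d\<^sup>2\<close>.
\<close>

lemma card_conflict_sets_le:
  "card (conflict_set G {x, y}) + card (private_conflict_set G M {x, y})
     \<le> 2 * d\<^sup>2 + num_edges_between G N1 N2"
proof -
  define X where "X = nbhd G x - {y}"
  define Y where "Y = nbhd G y - {x}"
  define U where "U = (nbhd G x \<union> nbhd G y) - {x, y}"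
  let ?T = "{e \<in> edges G. e \<inter> U \<noteq> {}}" and ?I = "{e \<in> edges G. e \<subseteq> U}"
  let ?B = "{e \<in> edges G. \<exists>u\<in>N1. \<exists>v\<in>N2. e = {u, v}}"
  note finE = finite_edges[OF simple]
  have "y \<in> nbhd G x" "x \<in> nbhd G y" using xy_edge by (auto simp: nbhd_def insert_commute)
  then have cX: "card X + 1 \<le> d" and cY: "card Y + 1 \<le> d"
    using degree_le[of x] degree_le[of y] card_Suc_Diff1[OF finite_nbhd[OF simple]]
    unfolding X_def Y_def degree_def by (metis Suc_eq_plus1)+
  have fin: "finite X" "finite Y" "finite U"
    using finite_nbhd[OF simple] by (auto simp: X_def Y_def U_def)
  have "U \<subseteq> X \<union> Y" by (auto simp: U_def X_def Y_def)
  then have "card U \<le> card X + card Y"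
    using fin card_mono[of "X \<union> Y" U] card_Un_le[of X Y] by simp
  then have cU: "card U + 2 \<le> 2 * d" using cX cY by linarith
  have "card ?T + card ?I = (\<Sum>u\<in>U. degree G u)"
    by (rule sum_degree_eq[OF simple fin(3), symmetric])
  also have "\<dots> \<le> card U * d"
    using sum_bounded_above[of U "degree G" d] degree_le by simp
  finally have TI: "card ?T + card ?I \<le> card U * d" .
  have "conflict_set G {x, y} \<subseteq> insert {x, y} ?T"
  proof
    fix e assume "e \<in> conflict_set G {x, y}"
    then have e: "e \<in> edges G" "edges_conflict G {x, y} e"
      using conflict_set_iff[OF simple xy_edge] by auto
    have nonloop: "a \<noteq> b" if "{a, b} \<in> edges G" for a b
      using edge_endpoints_distinct[OF simple that] .
    show "e \<in> insert {x, y} ?T"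
    proof (cases "e \<inter> {x, y} = {}")
      case True
      then show ?thesis
        using e unfolding edges_conflict_def U_def nbhd_def by blast
    next
      case False
      then obtain z where z: "z \<in> e" "z = x \<or> z = y" by blast
      obtain w where w: "e = {z, w}" using edge_eq_insert_endpoint[OF simple e(1) z(1)] by blast
      then have "w \<noteq> z" using nonloop e by blast
      then show ?thesis
        using w z(2) e(1) by (auto simp: U_def nbhd_def insert_commute)
    qed
  qed
  then have "card (conflict_set G {x, y}) \<le> card (insert {x, y} ?T)"
    using finE by (intro card_mono) auto
  also have "\<dots> \<le> card ?T + 1" using finE by (simp add: card_insert_if)
  finally have C: "card (conflict_set G {x, y}) \<le> card ?T + 1" .
  let ?P = "{{x, y}} \<union> (\<lambda>u. {x, u}) ` X \<union> (\<lambda>u. {y, u}) ` Y \<union> ?I \<union> ?B"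
  have card_Un5: "card (P1 \<union> P2 \<union> P3 \<union> P4 \<union> P5) \<le> card P1 + card P2 + card P3 + card P4 + card P5"
    for P1 P2 P3 P4 P5 :: "'a set set"
    using card_Un_le[of P1 P2] card_Un_le[of "P1 \<union> P2" P3] card_Un_le[of "P1 \<union> P2 \<union> P3" P4]
      card_Un_le[of "P1 \<union> P2 \<union> P3 \<union> P4" P5] by linarith
  have "private_conflict_set G M {x, y} \<subseteq> ?P"
  proof
    fix e assume ep: "e \<in> private_conflict_set G M {x, y}"
    then have e: "e \<in> edges G" "edges_conflict G {x, y} e"
      using private_conflict_set_iff[OF simple M_edges xy] by auto
    have inN: "v \<in> N1 \<or> v \<in> N2" if "v \<in> e" "v \<noteq> x" "v \<noteq> y" for v
      using that ep e(1) simple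
      unfolding N1_def N2_def closed_nbhd_def finite_simple_graph_def by blast
    have N1U: "N1 \<subseteq> U" by (auto simp: N1_def U_def)
    show "e \<in> ?P"
    proof (cases "x \<in> e \<or> y \<in> e")
      case True
      then obtain z where z: "z \<in> e" "z = x \<or> z = y" by blast
      obtain w where w: "e = {z, w}" using edge_eq_insert_endpoint[OF simple e(1) z(1)] by blast
      show ?thesis
        using w z(2) e(1) by (auto simp: X_def Y_def nbhd_def insert_commute)
    next
      case False
      then obtain u where u: "u \<in> e" "u \<in> nbhd G x \<union> nbhd G y"
        using e(2) unfolding edges_conflict_def nbhd_def by blast
      then have uN: "u \<in> N1" using ep False by (auto simp: N1_def)
      obtain w where w: "e = {u, w}" using edge_eq_insert_endpoint[OF simple e(1) u(1)] by blast
      then have "w \<in> N1 \<or> w \<in> N2" using inN[of w] False by auto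
      then show ?thesis using w uN N1U e(1) by blast
    qed
  qed
  then have "card (private_conflict_set G M {x, y}) \<le> card ?P"
    using finE fin by (intro card_mono) auto
  also have "\<dots> \<le> card {{x, y}} + card ((\<lambda>u. {x, u}) ` X) + card ((\<lambda>u. {y, u}) ` Y)
      + card ?I + card ?B"
    by (rule card_Un5)
  also have "\<dots> \<le> 1 + card X + card Y + card ?I + num_edges_between G N1 N2"
    unfolding num_edges_between_def by (intro add_mono card_image_le fin) auto
  finally have P: "card (private_conflict_set G M {x, y})
      \<le> 1 + card X + card Y + card ?I + num_edges_between G N1 N2" .
  have "card U * d \<le> (2 * d - 2) * d" using cU by (intro mult_right_mono) auto
  also have "(2 * d - 2) * d + 2 * d = 2 * d\<^sup>2"
    using cX by (simp add: power2_eq_square diff_mult_distrib)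
  finally have "card U * d + 2 * d \<le> 2 * d\<^sup>2"
    by (simp add: power2_eq_square diff_mult_distrib)
  then show ?thesis using C P TI cX cY by linarith
qed

end

text \<open>
  An edge in exactly one conflict set is counted a second time as a private edge; any other edge lies
  in at least two conflict sets.
\<close>

lemma (in locally_optimal_matching) twice_num_edges_le:
  "2 * num_edges G \<le>
     (\<Sum>e\<in>M. card (conflict_set G e) + card (private_conflict_set G M e))"
proof -
  note finE = finite_edges[OF simple]
  have finM: "finite M" using M_edges finE finite_subset by blast
  have sub: "conflict_set G e \<subseteq> edges G" "private_conflict_set G M e \<subseteq> edges G" for e
    by (auto simp: conflict_set_def private_conflict_set_def)
  define c where "c e f = (if f \<in> conflict_set G e then 1 else 0::nat)
    + (if f \<in> private_conflict_set G M e then 1 else 0)" for e f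
  have card_c: "card (conflict_set G e) + card (private_conflict_set G M e) = (\<Sum>f\<in>edges G. c e f)"
    for e
    using finE sub[of e] by (simp add: c_def sum.distrib sum.If_cases Int_absorb1)
  have "2 \<le> (\<Sum>e\<in>M. c e f)" if f: "f \<in> edges G" for f
  proof -
    obtain e where e: "e \<in> M" "edges_conflict G e f" using M_dominating[OF f] by blast
    then have ef: "f \<in> conflict_set G e" using conflict_set_iff[OF simple] M_edges f by blast
    show ?thesis
    proof (cases "f \<in> private_conflict_set G M e")
      case True
      then have "c e f = 2" using ef by (simp add: c_def)
      then show ?thesis using member_le_sum[OF e(1), of "\<lambda>e. c e f"] finM by simp
    next
      case False
      then obtain h where h: "h \<in> M" "h \<noteq> e" "f \<in> conflict_set G h"
        using ef by (auto simp: private_conflict_set_def)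
      have "2 \<le> (\<Sum>e\<in>{e, h}. c e f)" using h ef by (simp add: c_def)
      also have "\<dots> \<le> (\<Sum>e\<in>M. c e f)" using e h finM by (intro sum_mono2) auto
      finally show ?thesis .
    qed
  qed
  then have "2 * num_edges G \<le> (\<Sum>f\<in>edges G. \<Sum>e\<in>M. c e f)"
    using sum_bounded_below[of "edges G" 2 "\<lambda>f. \<Sum>e\<in>M. c e f"] by (simp add: num_edges_def)
  also have "\<dots> = (\<Sum>e\<in>M. \<Sum>f\<in>edges G. c e f)" by (rule sum.swap)
  finally show ?thesis by (simp add: card_c)
qed

theorem theorem4:
  fixes G :: "'a graph" and d :: nat and M :: "'a set set"
  assumes "d \<ge> 3"
    and "finite_simple_graph G"
    and "C4_free G"
    and "max_degree G = d"
    and "local_search_output G M"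
  shows "(\<forall>x y N\<^sub>1 N\<^sub>2.
            {x, y} \<in> M \<longrightarrow>
            N\<^sub>1 = {v \<in> (nbhd G x \<union> nbhd G y) - {x, y}.
                   \<exists>e\<in>private_conflict_set G M {x, y}. v \<in> e} \<longrightarrow>
            N\<^sub>2 = {v \<in> verts G - (closed_nbhd G x \<union> closed_nbhd G y).
                   \<exists>e\<in>private_conflict_set G M {x, y}. v \<in> e} \<longrightarrow>
            real (num_edges_between G N\<^sub>1 N\<^sub>2) \<le> max (real d) ((real d)\<^sup>2 / 4))
       \<and> real (card M) \<ge>
           real (num_edges G) / max ((real d)\<^sup>2 + real d / 2) (9 / 8 * (real d)\<^sup>2)"
proof -
  interpret locally_optimal_matching G d M
    using local_search_output_locally_optimal assms by (metis order_refl)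
  have edge: "locally_optimal_matching_edge G d M x y" if "{x, y} \<in> M" for x y
    by unfold_locales (rule that)
  have between: "real (num_edges_between G (locally_optimal_matching_edge.N1 G M x y)
      (locally_optimal_matching_edge.N2 G M x y)) \<le> max (real d) ((real d)\<^sup>2 / 4)" (is "real ?m \<le> _")
    if "{x, y} \<in> M" for x y
  proof -
    have "?m \<le> d \<or> 4 * ?m \<le> d\<^sup>2"
      by (rule locally_optimal_matching_edge.num_edges_between_le[OF edge[OF that]])
    then have "real ?m \<le> real d \<or> 4 * real ?m \<le> (real d)\<^sup>2"
      by (metis of_nat_le_iff of_nat_mult of_nat_numeral of_nat_power)
    then show ?thesis by (auto simp: max_def)
  qed
  define c where "c = max ((real d)\<^sup>2 + real d / 2) (9 / 8 * (real d)\<^sup>2)"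
  have c: "2 * c = 2 * (real d)\<^sup>2 + max (real d) ((real d)\<^sup>2 / 4)"
    by (auto simp: c_def max_def)
  have "c > 0" using assms(1) by (simp add: c_def less_max_iff_disj)
  have edge_le: "real (card (conflict_set G e) + card (private_conflict_set G M e)) \<le> 2 * c"
    if e: "e \<in> M" for e
  proof -
    obtain x y where xy: "e = {x, y}" using edgeE[OF simple] M_edges e by blast
    then have M: "{x, y} \<in> M" using e by simp
    have "real (card (conflict_set G e) + card (private_conflict_set G M e))
      \<le> real (2 * d\<^sup>2 + num_edges_between G (locally_optimal_matching_edge.N1 G M x y)
      (locally_optimal_matching_edge.N2 G M x y))"
      unfolding xy of_nat_le_iff
      by (rule locally_optimal_matching_edge.card_conflict_sets_le[OF edge[OF M]])
    also have "\<dots> \<le> 2 * c" using between[OF M] by (simp add: c)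
    finally show ?thesis .
  qed
  have "2 * real (num_edges G)
      \<le> real (\<Sum>e\<in>M. card (conflict_set G e) + card (private_conflict_set G M e))"
    using of_nat_mono[OF twice_num_edges_le, where 'a = real] by simp
  also have "\<dots> \<le> (\<Sum>e\<in>M. 2 * c)"
    unfolding of_nat_sum using edge_le by (intro sum_mono) auto
  finally have "real (num_edges G) \<le> real (card M) * c" by simp
  then have "real (num_edges G) / c \<le> real (card M)"
    using \<open>c > 0\<close> by (simp add: divide_le_eq)
  moreover have "\<forall>x y N\<^sub>1 N\<^sub>2.
            {x, y} \<in> M \<longrightarrow>
            N\<^sub>1 = {v \<in> (nbhd G x \<union> nbhd G y) - {x, y}.
                   \<exists>e\<in>private_conflict_set G M {x, y}. v \<in> e} \<longrightarrow>
            N\<^sub>2 = {v \<in> verts G - (closed_nbhd G x \<union> closed_nbhd G y).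
                   \<exists>e\<in>private_conflict_set G M {x, y}. v \<in> e} \<longrightarrow>
            real (num_edges_between G N\<^sub>1 N\<^sub>2) \<le> max (real d) ((real d)\<^sup>2 / 4)"
    using between
    by (simp add: locally_optimal_matching_edge.N1_def[OF edge]
        locally_optimal_matching_edge.N2_def[OF edge])
  ultimately show ?thesis unfolding c_def by blast
qed

end
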